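(* Let $\mathrm{EVM}\in[0,1]$ and $\kappa=1-\mathrm{EVM}^2$, and let $$R_\Sigma=\frac1S\sum_{\nu=0}^{S-1}\log_2\det\Big(\mathbf I_M+\frac{1}{\sigma^2}\bar{\mathbf H}[\nu]\mathbf D_\rho[\nu]\bar{\mathbf H}[\nu]^{\mathrm H}\Big)-\frac1S\sum_{\nu=0}^{S-1}\log_2\det\Big(\mathbf I_M+\frac{1-\kappa}{\sigma^2}\bar{\mathbf H}[\nu]\mathbf D_\rho[\nu]\bar{\mathbf H}[\nu]^{\mathrm H}\Big),$$ where $\bar{\mathbf H}[\nu]\in\mathbb{C}^{M\times K}$ is the channel matrix and $\mathbf D_\rho[\nu]$ is the $K\times K$ diagonal power allocation matrix on subcarrier $\nu=0,\dots,S-1$, and $\sigma^2>0$ is the noise variance. Suppose the power allocation is selected as $\mathbf D_\rho[\nu]=\rho\,\mathbf A[\nu]$, where $\mathbf A[\nu]=\mathrm{diag}(a_1[\nu],\dots,a_K[\nu])$ is a fixed matrix and $\rho$ is a parameter. If $\bar{\mathbf H}[\nu]$ has rank $K$ (for every $\nu$) and $\mathrm{EVM}>0$, then $$\lim_{\rho\to\infty}R_\Sigma=K\log_2\Big(\frac{1}{\mathrm{EVM}^2}\Big).$$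
   Context: $(\cdot)^{\mathrm H}$ denotes the conjugate transpose and $\mathbf I_M$ the $M\times M$ identity matrix. Setting: $K$ single-antenna users transmit to a base station with $M$ antennas over $S$ OFDM subcarriers. $\bar{\mathbf H}[\nu]=[\bar{\mathbf h}_1[\nu],\dots,\bar{\mathbf h}_K[\nu]]$ collects the users' channel vectors $\bar{\mathbf h}_k[\nu]\in\mathbb{C}^M$ on subcarrier $\nu$, and $\mathbf D_\rho[\nu]=\mathrm{diag}(\rho_1[\nu],\dots,\rho_K[\nu])$, where $\rho_k[\nu]$ is the transmit power of user $k$ on subcarrier $\nu$. $\mathrm{EVM}$ (error vector magnitude) is the hardware distortion level: a fraction $\kappa=1-\mathrm{EVM}^2$ of each user's transmit power is useful signal and a fraction $1-\kappa=\mathrm{EVM}^2$ is uncorrelated distortion. $R_\Sigma$ is the uplink sum rate with successive interference cancellation, averaged over the $S$ subcarriers.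
   Formalization: The weights a_k[ν] are assumed strictly positive for every user and subcarrier; without this the claim fails, e.g. A[ν]=0 with 0<EVM<1 gives R_Σ=0 for all ρ while K·log₂(1/EVM²)>0. *)

theory Defs
  imports "HOL-Analysis.Analysis"
begin

definition adjoint_mat :: "complex^'n^'m \<Rightarrow> complex^'m^'n" where
  "adjoint_mat A = (\<chi> i j. cnj (A $ j $ i))"

definition diag_mat :: "('k \<Rightarrow> real) \<Rightarrow> complex^'k^'k" where
  "diag_mat p = (\<chi> i j. if i = j then complex_of_real (p i) else 0)"

text \<open>
  The Gram-type determinants below are real for real diagonal \<open>D\<close> (see
  \<open>det_id_plus_real\<close>) and at least 1 for nonnegative powers, so taking the real part of
  the complex-valued \<^const>\<open>det\<close> only changes the type and discards nothing.
\<close>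

definition log2_det :: "complex^'m^'m \<Rightarrow> real" where
  "log2_det A = log 2 (Re (det A))"

definition sum_rate ::
  "nat \<Rightarrow> real \<Rightarrow> real \<Rightarrow> (nat \<Rightarrow> complex^'k^'m) \<Rightarrow> (nat \<Rightarrow> complex^'k^'k) \<Rightarrow> real" where
  "sum_rate S \<sigma> \<kappa> H D =
     (1 / real S) * (\<Sum>\<nu><S. log2_det
        (mat 1 + (1 / \<sigma>\<^sup>2) *\<^sub>R (H \<nu> ** D \<nu> ** adjoint_mat (H \<nu>))))
   - (1 / real S) * (\<Sum>\<nu><S. log2_det
        (mat 1 + ((1 - \<kappa>) / \<sigma>\<^sup>2) *\<^sub>R (H \<nu> ** D \<nu> ** adjoint_mat (H \<nu>))))"

lemma det_adjoint_mat: "det (adjoint_mat A) = cnj (det A)" for A :: "complex^'n^'n"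
proof -
  have "adjoint_mat A = transpose (\<chi> i j. cnj (A $ i $ j))"
    by (simp add: adjoint_mat_def transpose_def)
  then have "det (adjoint_mat A) = det (\<chi> i j. cnj (A $ i $ j))"
    by (simp add: det_transpose)
  also have "\<dots> = cnj (det A)"
    by (simp add: det_def cnj_sum cnj_prod)
  finally show ?thesis .
qed

lemma adjoint_mat_mult: "adjoint_mat (A ** B) = adjoint_mat B ** adjoint_mat A"
  by (simp add: adjoint_mat_def matrix_matrix_mult_def vec_eq_iff cnj_sum mult.commute)

lemma adjoint_mat_adjoint_mat [simp]: "adjoint_mat (adjoint_mat A) = A"
  by (simp add: adjoint_mat_def vec_eq_iff)

lemma adjoint_diag_mat [simp]: "adjoint_mat (diag_mat p) = diag_mat p"
  by (simp add: adjoint_mat_def diag_mat_def vec_eq_iff)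

lemma det_id_plus_real:
  fixes H :: "complex^'k^'m"
  shows "det (mat 1 + c *\<^sub>R (H ** diag_mat p ** adjoint_mat H)) \<in> \<real>"
proof -
  define G where "G = H ** diag_mat p ** adjoint_mat H"
  have G: "adjoint_mat G = G"
    by (simp add: G_def adjoint_mat_mult matrix_mul_assoc)
  have "adjoint_mat (mat 1 + c *\<^sub>R G) = mat 1 + c *\<^sub>R adjoint_mat G"
    by (simp add: adjoint_mat_def mat_def vec_eq_iff)
  then have "cnj (det (mat 1 + c *\<^sub>R G)) = det (mat 1 + c *\<^sub>R G)"
    by (metis G det_adjoint_mat)
  then show ?thesis
    by (simp add: G_def Reals_cnj_iff)
qed

end

theory Submission
  imports Defs
begin

text \<open>
  Sylvester's identity turns each determinant into
  \<open>det (I\<^sub>K + t A H\<^sup>H H)\<close>, a polynomial in \<open>t\<close> of degree \<open>K\<close>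
  whose leading coefficient \<open>det (A H\<^sup>H H)\<close> is nonzero because \<open>H\<close> is injective.
  Hence \<open>log\<^sub>2 det (I\<^sub>M + t H A H\<^sup>H) - K log\<^sub>2 t\<close> converges as
  \<open>t\<close> tends to infinity, and taking the difference of this quantity at \<open>t = \<rho>/\<sigma>\<^sup>2\<close>
  and at \<open>t = EVM\<^sup>2 \<rho>/\<sigma>\<^sup>2\<close> leaves \<open>K log\<^sub>2 (1/EVM\<^sup>2)\<close>.
\<close>

text \<open>Rows outside \<open>range f\<close> are unit rows, so in the Leibniz sum only
  permutations fixing every such index contribute. Conjugation by \<open>f\<close> matches them with
  the permutations of the smaller index type and preserves signs.\<close>

lemma det_eq_det_principal_submatrix:
  fixes T :: "'a::comm_ring_1^'q^'q" and f :: "'n::finite \<Rightarrow> 'q"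
  assumes f: "inj f"
    and T: "\<And>i j. i \<notin> range f \<Longrightarrow> T $ i $ j = (if i = j then 1 else 0)"
  shows "det T = det (\<chi> i j. T $ f i $ f j)"
proof -
  let ?term = "\<lambda>p. of_int (sign p) * (\<Prod>i\<in>UNIV. T $ i $ p i)"
  have bij: "bij_betw (map_permutation UNIV f) {p. p permutes UNIV} {p. p permutes range f}"
  proof -
    have "bij_betw f UNIV (range f)"
      using f by (simp add: bij_betw_def)
    from bij_betw_permutations[OF this] show ?thesis
      by (rule bij_betw_cong[THEN iffD1, rotated])
         (auto simp: map_permutation_def restrict_id_def fun_eq_iff)
  qed
  have "det T = (\<Sum>p | p permutes range f. ?term p)"
    unfolding det_def
  proof (rule sum.mono_neutral_right)
    show "{p. p permutes range f} \<subseteq> {p. p permutes UNIV}"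
      using permutes_subset by blast
    show "\<forall>p\<in>{p. p permutes UNIV} - {p. p permutes range f}. ?term p = 0"
    proof
      fix p assume "p \<in> {p. p permutes UNIV} - {p. p permutes range f}"
      \<comment> \<open>A permutation that does not permute \<open>range f\<close> must move some
        index outside it, and there it selects an off-diagonal zero of a unit row.\<close>
      then obtain i where i: "i \<notin> range f" "p i \<noteq> i"
        using permutes_superset[of p UNIV "range f"] by auto
      then have "T $ i $ p i = 0"
        using T[of i "p i"] by simp
      then show "?term p = 0"
        by (metis (mono_tags, lifting) UNIV_I finite mult_zero_right prod_zero)
    qed
  qed (simp add: finite_permutations)
  also have "\<dots> = (\<Sum>p | p permutes UNIV. ?term (map_permutation UNIV f p))"
    by (rule sum.reindex_bij_betw[OF bij, symmetric])
  also have "\<dots> = (\<Sum>p | p permutes UNIV. of_int (sign p) * (\<Prod>i\<in>UNIV. T $ f i $ f (p i)))"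
  proof (rule sum.cong[OF refl])
    fix p assume "p \<in> {p. p permutes (UNIV :: 'n set)}"
    then have p: "p permutes UNIV" by simp
    have "(\<Prod>i\<in>UNIV. T $ i $ map_permutation UNIV f p i)
        = (\<Prod>i\<in>range f. T $ i $ map_permutation UNIV f p i)"
      by (rule prod.mono_neutral_right) (auto simp: T map_permutation_def restrict_id_def)
    also have "\<dots> = (\<Prod>i\<in>UNIV. T $ f i $ f (p i))"
      using f by (simp add: prod.reindex map_permutation_apply)
    finally show "?term (map_permutation UNIV f p)
        = of_int (sign p) * (\<Prod>i\<in>UNIV. T $ f i $ f (p i))"
      using f p by (simp add: sign_map_permutation)
  qed
  finally show ?thesis
    by (simp add: det_def)
qed

text \<open>Dimensions are types, so the two block sizes are joined by a sum index type:
  \<open>Inl\<close> addresses the first block, \<open>Inr\<close> the second.\<close>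

definition block_mat ::
  "'a^'m^'m \<Rightarrow> 'a^'n^'m \<Rightarrow> 'a^'m^'n \<Rightarrow> 'a^'n^'n \<Rightarrow> 'a^('m + 'n)^('m + 'n)" where
  "block_mat A B C D = (\<chi> i j. case (i, j) of
     (Inl i, Inl j) \<Rightarrow> A $ i $ j | (Inl i, Inr j) \<Rightarrow> B $ i $ j
   | (Inr i, Inl j) \<Rightarrow> C $ i $ j | (Inr i, Inr j) \<Rightarrow> D $ i $ j)"

lemma block_mat_nth [simp]:
  "block_mat A B C D $ Inl i $ Inl j = A $ i $ j"
  "block_mat A B C D $ Inl i $ Inr k = B $ i $ k"
  "block_mat A B C D $ Inr l $ Inl j = C $ l $ j"
  "block_mat A B C D $ Inr l $ Inr k = D $ l $ k"
  by (simp_all add: block_mat_def)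

lemma block_mat_mult:
  "block_mat A B C D ** block_mat A' B' C' D'
   = block_mat (A ** A' + B ** C') (A ** B' + B ** D') (C ** A' + D ** C') (C ** B' + D ** D')"
proof -
  have split: "(\<Sum>k\<in>UNIV. f k) = (\<Sum>k\<in>UNIV. f (Inl k)) + (\<Sum>k\<in>UNIV. f (Inr k))"
    for f :: "'b + 'c \<Rightarrow> 'a"
    unfolding UNIV_Plus_UNIV[symmetric] by (subst sum.Plus) simp_all
  show ?thesis
    unfolding vec_eq_iff
  proof (intro allI)
    fix i j
    show "(block_mat A B C D ** block_mat A' B' C' D') $ i $ j
      = block_mat (A ** A' + B ** C') (A ** B' + B ** D')
          (C ** A' + D ** C') (C ** B' + D ** D') $ i $ j"
      by (cases i; cases j) (simp_all add: matrix_matrix_mult_def split)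
  qed
qed

text \<open>The lower block rows are unit rows, so the determinant reduces to the principal
  submatrix indexed by \<open>Inl\<close>.\<close>

lemma det_block_mat_upper:
  fixes A :: "'a::comm_ring_1^'m^'m"
  shows "det (block_mat A B 0 (mat 1)) = det A"
proof -
  have "det (block_mat A B 0 (mat 1))
      = det (\<chi> i j. block_mat A B 0 (mat 1) $ Inl i $ Inl j)"
  proof (rule det_eq_det_principal_submatrix)
    fix i j
    assume "i \<notin> range (Inl :: 'm \<Rightarrow> 'm + 'b)"
    then show "block_mat A B 0 (mat 1) $ i $ j = (if i = j then 1 else 0)"
      by (cases i; cases j) (auto simp: mat_def)
  qed simp
  then show ?thesis by simp
qed

lemma det_block_mat_lower:
  fixes D :: "'a::comm_ring_1^'n^'n"
  shows "det (block_mat (mat 1) 0 C D) = det D"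
proof -
  have "det (block_mat (mat 1) 0 C D)
      = det (\<chi> i j. block_mat (mat 1) 0 C D $ Inr i $ Inr j)"
  proof (rule det_eq_det_principal_submatrix)
    fix i j
    assume "i \<notin> range (Inr :: 'n \<Rightarrow> 'b + 'n)"
    then show "block_mat (mat 1) 0 C D $ i $ j = (if i = j then 1 else 0)"
      by (cases i; cases j) (auto simp: mat_def)
  qed simp
  then show ?thesis by simp
qed

text \<open>Sylvester's identity. The two sides are the determinants of the two Schur complements of
  \<open>?M\<close>, each exposed by multiplying with a block triangular matrix of determinant
  1.\<close>

lemma det_one_plus_mult_commute:
  fixes A :: "'a::comm_ring_1^'n^'m" and B :: "'a^'m^'n"
  shows "det (mat 1 + A ** B) = det (mat 1 + B ** A)"
proof -
  let ?M = "block_mat (mat 1) (- A) B (mat 1)"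
  have neg: "- P ** Q = - (P ** Q)" "P ** - Q = - (P ** Q)"
    for P :: "'a^'q^'p" and Q :: "'a^'r^'q"
    by (simp_all add: matrix_matrix_mult_def vec_eq_iff sum_negf)
  have mul0: "X ** (0 :: 'a^'r^'q) = 0" for X :: "'a^'q^'p"
    by (simp add: matrix_matrix_mult_def vec_eq_iff)
  \<comment> \<open>This factor clears the upper right block; the one used below for
    \<open>A ** B\<close> clears the lower left block.\<close>
  have "?M ** block_mat (mat 1) A 0 (mat 1) = block_mat (mat 1) 0 B (mat 1 + B ** A)"
    by (simp add: block_mat_mult neg mul0 add.commute)
  from arg_cong[OF this, of det] have "det ?M = det (mat 1 + B ** A)"
    by (simp add: det_mul det_block_mat_upper det_block_mat_lower)
  moreover
  have "?M ** block_mat (mat 1) 0 (- B) (mat 1) = block_mat (mat 1 + A ** B) (- A) 0 (mat 1)"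
    by (simp add: block_mat_mult neg mul0)
  from arg_cong[OF this, of det] have "det ?M = det (mat 1 + A ** B)"
    by (simp add: det_mul det_block_mat_upper det_block_mat_lower)
  ultimately show ?thesis by simp
qed

lemma matrix_mult_scaleR:
  fixes A :: "'a::real_algebra_1^'n^'m" and B :: "'a^'p^'n"
  shows "A ** (c *\<^sub>R B) = c *\<^sub>R (A ** B)" and "(c *\<^sub>R A) ** B = c *\<^sub>R (A ** B)"
  by (simp_all add: matrix_matrix_mult_def vec_eq_iff scaleR_sum_right)

lemma det_scaleR:
  fixes A :: "'a::{real_algebra_1,comm_ring_1}^'n^'n"
  shows "det (c *\<^sub>R A) = c ^ CARD('n) *\<^sub>R det A"
proof -
  have "(\<Prod>i\<in>UNIV. c *\<^sub>R x i) = c ^ CARD('n) *\<^sub>R (\<Prod>i\<in>UNIV. x i)" for x :: "'n \<Rightarrow> 'a"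
    by (simp add: scaleR_conv_of_real prod.distrib)
  then show ?thesis
    by (simp add: det_def scaleR_sum_right)
qed

lemma tendsto_det:
  fixes A :: "'b \<Rightarrow> 'a::{real_normed_algebra_1,comm_ring_1}^'n^'n"
  assumes "(A \<longlongrightarrow> B) F"
  shows "((\<lambda>x. det (A x)) \<longlongrightarrow> det B) F"
  unfolding det_def by (intro tendsto_intros assms)

text \<open>Pulling \<open>t\<close> out of every row leaves
  \<open>inverse t *\<^sub>R mat 1 + X\<close>, which tends to \<open>X\<close>; continuity of
  \<open>det\<close> does the rest.\<close>

lemma det_one_plus_scaleR_leading_coeff:
  fixes X :: "'a::{real_normed_algebra_1,comm_ring_1}^'n^'n"
  shows "((\<lambda>t. det (mat 1 + t *\<^sub>R X) /\<^sub>R t ^ CARD('n)) \<longlongrightarrow> det X) at_top"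
proof -
  have "((\<lambda>t. inverse t *\<^sub>R mat 1 + X) \<longlongrightarrow> 0 *\<^sub>R mat 1 + X) at_top"
    by (intro tendsto_intros tendsto_inverse_0_at_top filterlim_ident)
  then have "((\<lambda>t. det (inverse t *\<^sub>R mat 1 + X)) \<longlongrightarrow> det X) at_top"
    using tendsto_det by fastforce
  moreover have "\<forall>\<^sub>F t in at_top.
      det (inverse t *\<^sub>R mat 1 + X) = det (mat 1 + t *\<^sub>R X) /\<^sub>R t ^ CARD('n)"
    using eventually_gt_at_top[of 0]
  proof eventually_elim
    case (elim t)
    then have "mat 1 + t *\<^sub>R X = t *\<^sub>R (inverse t *\<^sub>R mat 1 + X)"
      by (simp add: scaleR_add_right)
    then show ?case
      using elim by (simp add: det_scaleR)
  qed
  ultimately show ?thesis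
    by (rule Lim_transform_eventually)
qed

lemma full_rank_ker:
  fixes A :: "'a::field^'n^'m"
  assumes "rank A = CARD('n)" and "A *v x = 0"
  shows "x = 0"
proof -
  \<comment> \<open>The rank is read as row rank: the rows span the whole space, which yields a left
    inverse and hence a trivial kernel.\<close>
  have "vec.span (rows A) = UNIV"
    using assms(1) vec.dim_eq_full[of "rows A"]
    by (simp add: row_rank_def_gen vec.dimension_def card_cart_basis)
  then show ?thesis
    using assms(2) matrix_left_invertible_span_rows_gen matrix_left_invertible_ker by blast
qed

text \<open>If the Gram matrix kills \<open>x\<close>, then the squared norm of
  \<open>H *v x\<close> vanishes, and full column rank forces \<open>x = 0\<close>.\<close>

lemma det_gram_nonzero:
  fixes H :: "complex^'k^'m"
  assumes "rank H = CARD('k)"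
  shows "det (adjoint_mat H ** H) \<noteq> 0"
proof -
  have "x = 0" if x: "(adjoint_mat H ** H) *v x = 0" for x
  proof -
    define y where "y = H *v x"
    have y0: "(\<Sum>i\<in>UNIV. cnj (H $ i $ j) * y $ i) = 0" for j
      using x unfolding matrix_vector_mul_assoc[symmetric] y_def[symmetric]
      by (simp add: vec_eq_iff matrix_vector_mult_def adjoint_mat_def)
    \<comment> \<open>Only the conjugated factor \<open>y\<close> is expanded, so that the inner sum
      becomes an entry of the adjoint of \<open>H\<close> applied to \<open>y\<close>.\<close>
    have "(\<Sum>i\<in>UNIV. cnj (y $ i) * y $ i)
        = (\<Sum>i\<in>UNIV. \<Sum>j\<in>UNIV. cnj (x $ j) * (cnj (H $ i $ j) * y $ i))"
      by (subst (1) y_def)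
         (simp add: matrix_vector_mult_def cnj_sum sum_distrib_left sum_distrib_right mult_ac)
    also have "\<dots> = (\<Sum>j\<in>UNIV. cnj (x $ j) * (\<Sum>i\<in>UNIV. cnj (H $ i $ j) * y $ i))"
      by (subst sum.swap) (simp add: sum_distrib_left)
    also have "\<dots> = 0"
      by (simp add: y0)
    finally have "complex_of_real (\<Sum>i\<in>UNIV. (cmod (y $ i))\<^sup>2) = 0"
      by (simp add: complex_norm_square mult.commute del: of_real_power)
    then have "(\<Sum>i\<in>UNIV. (cmod (y $ i))\<^sup>2) = 0"
      by (simp only: of_real_eq_0_iff)
    then have "y = 0"
      by (simp add: sum_nonneg_eq_0_iff vec_eq_iff)
    then show "x = 0"
      using full_rank_ker[OF assms, of x] by (simp add: y_def)
  qed
  then show ?thesis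
    using invertible_det_nz invertible_left_inverse matrix_left_invertible_ker by blast
qed

text \<open>Existence of \<open>L\<close> suffices: the rate is a difference of two such
  expressions, in which \<open>L\<close> cancels.\<close>

lemma log2_det_gram_asymptotics:
  fixes H :: "complex^'k^'m"
  assumes rank: "rank H = CARD('k)" and p: "\<And>k. p k > 0"
  obtains L where
    "((\<lambda>t. log2_det (mat 1 + t *\<^sub>R (H ** diag_mat p ** adjoint_mat H))
         - real CARD('k) * log 2 t) \<longlongrightarrow> L) at_top"
proof -
  define X where "X = diag_mat p ** (adjoint_mat H ** H)"
  define d where "d = (\<lambda>t. det (mat 1 + t *\<^sub>R X))"
  \<comment> \<open>Passing to the smaller Gram side makes the growth exponent the number of users
    rather than the number of antennas.\<close>
  have d: "det (mat 1 + t *\<^sub>R (H ** diag_mat p ** adjoint_mat H)) = d t" for t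
    using det_one_plus_mult_commute[of H "t *\<^sub>R (diag_mat p ** adjoint_mat H)"]
    by (simp add: d_def X_def matrix_mult_scaleR matrix_mul_assoc)
  have "det (diag_mat p) = complex_of_real (\<Prod>k\<in>UNIV. p k)"
    by (subst det_diagonal) (simp_all add: diag_mat_def)
  moreover have "det (adjoint_mat H ** H) \<in> \<real>"
    by (metis Reals_cnj_iff adjoint_mat_adjoint_mat adjoint_mat_mult det_adjoint_mat)
  ultimately have "det X \<in> \<real>"
    by (simp add: X_def det_mul)
  moreover have "det X \<noteq> 0"
    using det_gram_nonzero[OF rank] \<open>det (diag_mat p) = _\<close> p
    by (simp add: X_def det_mul less_imp_neq[symmetric])
  \<comment> \<open>Since \<open>log2_det\<close> sees only real parts, nonvanishing of the complex
    determinant is not enough by itself; realness transfers it to \<open>Re\<close>.\<close>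
  ultimately have nz: "Re (det X) \<noteq> 0"
    by (metis complex_is_Real_iff complex_eq_iff zero_complex.sel)
  have lim: "((\<lambda>t. Re (d t) / t ^ CARD('k)) \<longlongrightarrow> Re (det X)) at_top"
    using tendsto_Re[OF det_one_plus_scaleR_leading_coeff[of X]]
    by (simp add: d_def field_simps)
  \<comment> \<open>\<open>ln\<close> is even on the reals, so the limit need only be nonzero.\<close>
  then have "((\<lambda>t. log 2 (Re (d t) / t ^ CARD('k))) \<longlongrightarrow> log 2 (Re (det X))) at_top"
    by (intro tendsto_log tendsto_const) (simp_all add: nz)
  moreover have "\<forall>\<^sub>F t in at_top. log 2 (Re (d t) / t ^ CARD('k))
      = log2_det (mat 1 + t *\<^sub>R (H ** diag_mat p ** adjoint_mat H)) - real CARD('k) * log 2 t"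
    using eventually_gt_at_top[of 0] tendsto_imp_eventually_ne[OF lim nz]
  proof eventually_elim
    case (elim t)
    then show ?case
      by (simp add: log2_det_def d log_divide log_nat_power)
  qed
  ultimately show thesis
    by (rule that[OF Lim_transform_eventually])
qed

theorem proposition1:
  fixes EVM \<kappa> \<sigma> :: real
    and S :: nat
    and H :: "nat \<Rightarrow> complex^'k^'m"
    and a :: "nat \<Rightarrow> 'k \<Rightarrow> real"
  assumes "0 \<le> EVM" and "EVM \<le> 1" and "\<kappa> = 1 - EVM\<^sup>2"
    and "\<sigma>\<^sup>2 > 0"
    and "S > 0"
    and "\<And>\<nu> k. \<nu> < S \<Longrightarrow> a \<nu> k > 0"
    and "\<And>\<nu>. \<nu> < S \<Longrightarrow> rank (H \<nu>) = CARD('k)"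
    and "EVM > 0"
  shows "((\<lambda>\<rho>. sum_rate S \<sigma> \<kappa> H (\<lambda>\<nu>. \<rho> *\<^sub>R diag_mat (a \<nu>)))
           \<longlongrightarrow> real CARD('k) * log 2 (1 / EVM\<^sup>2)) at_top"
proof -
  let ?K = "real CARD('k)"
  define g where "g = (\<lambda>\<nu> t. log2_det
    (mat 1 + t *\<^sub>R (H \<nu> ** diag_mat (a \<nu>) ** adjoint_mat (H \<nu>))))"
  \<comment> \<open>Because \<open>1 - \<kappa>\<close> equals \<open>EVM\<^sup>2\<close>, both
    determinants of the rate are the same function \<open>g \<nu>\<close>, evaluated at
    \<open>c * \<rho>\<close> and \<open>c' * \<rho>\<close>.\<close>
  define c where "c = 1 / \<sigma>\<^sup>2"
  define c' where "c' = EVM\<^sup>2 / \<sigma>\<^sup>2"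
  have pos: "c > 0" "c' > 0"
    using assms by (simp_all add: c_def c'_def)
  have rate: "sum_rate S \<sigma> \<kappa> H (\<lambda>\<nu>. \<rho> *\<^sub>R diag_mat (a \<nu>))
      = (1 / real S) * (\<Sum>\<nu><S. g \<nu> (c * \<rho>) - g \<nu> (c' * \<rho>))" for \<rho>
    using assms(3)
    by (simp add: sum_rate_def g_def c_def c'_def matrix_mult_scaleR sum_subtractf
        right_diff_distrib)
  have "((\<lambda>\<rho>. g \<nu> (c * \<rho>) - g \<nu> (c' * \<rho>)) \<longlongrightarrow> ?K * log 2 (1 / EVM\<^sup>2)) at_top"
    if \<nu>: "\<nu> < S" for \<nu>
  proof -
    obtain L where L: "((\<lambda>t. g \<nu> t - ?K * log 2 t) \<longlongrightarrow> L) at_top"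
      unfolding g_def using log2_det_gram_asymptotics[of "H \<nu>" "a \<nu>"] assms(6,7) \<nu> by blast
    have scaled: "((\<lambda>\<rho>. g \<nu> (b * \<rho>) - ?K * log 2 (b * \<rho>)) \<longlongrightarrow> L) at_top" if "b > 0" for b
      by (rule filterlim_compose[OF L])
         (rule filterlim_tendsto_pos_mult_at_top[OF tendsto_const that filterlim_ident])
    \<comment> \<open>Both normalized terms share the limit \<open>L\<close>. The added constant
      restores the difference of the subtracted logarithms, since \<open>c / c'\<close> is
      \<open>1 / EVM\<^sup>2\<close>.\<close>
    have "((\<lambda>\<rho>. (g \<nu> (c * \<rho>) - ?K * log 2 (c * \<rho>)) - (g \<nu> (c' * \<rho>) - ?K * log 2 (c' * \<rho>))
        + ?K * log 2 (1 / EVM\<^sup>2)) \<longlongrightarrow> L - L + ?K * log 2 (1 / EVM\<^sup>2)) at_top"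
      by (intro tendsto_intros scaled pos)
    then have "((\<lambda>\<rho>. (g \<nu> (c * \<rho>) - ?K * log 2 (c * \<rho>)) - (g \<nu> (c' * \<rho>) - ?K * log 2 (c' * \<rho>))
        + ?K * log 2 (1 / EVM\<^sup>2)) \<longlongrightarrow> ?K * log 2 (1 / EVM\<^sup>2)) at_top"
      by simp
    moreover have "\<forall>\<^sub>F \<rho> in at_top.
        (g \<nu> (c * \<rho>) - ?K * log 2 (c * \<rho>)) - (g \<nu> (c' * \<rho>) - ?K * log 2 (c' * \<rho>))
          + ?K * log 2 (1 / EVM\<^sup>2) = g \<nu> (c * \<rho>) - g \<nu> (c' * \<rho>)"
      using eventually_gt_at_top[of 0]
    proof eventually_elim
      case (elim \<rho>)
      have "log 2 (c' * \<rho>) = log 2 (EVM\<^sup>2) + log 2 (c * \<rho>)"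
        using elim pos assms(8) log_mult_pos[of "EVM\<^sup>2" "c * \<rho>" 2] by (simp add: c_def c'_def)
      moreover have "log 2 (1 / EVM\<^sup>2) = - log 2 (EVM\<^sup>2)"
        using assms(8) by (simp add: log_divide)
      ultimately show ?case
        by (simp add: algebra_simps)
    qed
    ultimately show ?thesis
      by (rule Lim_transform_eventually)
  qed
  \<comment> \<open>Every subcarrier has the same limit, so the average over \<open>S > 0\<close> of
    them is that limit.\<close>
  then have "((\<lambda>\<rho>. (1 / real S) * (\<Sum>\<nu><S. g \<nu> (c * \<rho>) - g \<nu> (c' * \<rho>)))
      \<longlongrightarrow> (1 / real S) * (\<Sum>\<nu><S. ?K * log 2 (1 / EVM\<^sup>2))) at_top"
    by (intro tendsto_mult_left tendsto_sum) simp
  then show ?thesis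
    using \<open>S > 0\<close> by (simp add: rate)
qed

end
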